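(* Consider the non-parametric weighted random graph mixture model with $Q\ge2$ groups. If the measures $\mu_{ql}$, $1\le q\le l\le Q$, are linearly independent, then the parameters $\{\pi_q\}_{1\le q\le Q}$ and $\{\mu_{ql}=(1-p_{ql})\delta_0+p_{ql}F_{ql}\}_{1\le q,l\le Q}$ are identifiable, up to label swapping, from the joint distribution of $K_9$.
   Context: Random graph mixture model: nodes have i.i.d. latent groups $Z_i\in\{1,\dots,Q\}$ with $\pi_q=\mathbb P(Z_i=q)\in(0,1)$, $\sum_q\pi_q=1$; edge variables $X_{ij}$ ($i<j$) are conditionally independent given all $Z$'s, with law of $X_{ij}$ depending only on $(Z_i,Z_j)$. Non-parametric weighted model: $X_{ij}$ takes values in $\mathbb R$ (or $\mathbb R^s$) and, given $Z_i=q,Z_j=l$, has law $\mu_{ql}=(1-p_{ql})\delta_0+p_{ql}F_{ql}$, where $p_{ql}\in(0,1]$, $\delta_0$ is the Dirac mass at $0$, $F_{ql}$ is an absolutely continuous probability measure, and $\mu_{ql}=\mu_{lq}$. $K_n$ denotes the collection of the $\binom n2$ edge variables among $n$ nodes. "Up to label swapping" means up to a permutation of $\{1,\dots,Q\}$ applied simultaneously to all group-indexed parameters. *)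

theory Defs
  imports "HOL-Probability.Probability"
begin

text \<open>Nodes of K_n are 0..n-1; edge variables are indexed by pairs (i,j) with i < j < n.\<close>
definition edges :: "nat \<Rightarrow> (nat \<times> nat) set" where
  "edges n = {(i, j). i < j \<and> j < n}"

definition np_edge_law :: "'a::euclidean_space measure \<Rightarrow> bool" where
  "np_edge_law m \<longleftrightarrow> sets m = sets borel \<and> prob_space m \<and>
     (\<exists>p F. 0 < p \<and> p \<le> 1 \<and> prob_space F \<and> sets F = sets borel \<and>
        absolutely_continuous lborel F \<and>
        (\<forall>A\<in>sets borel. measure m A = (1 - p) * (indicator A 0 :: real) + p * measure F A))"

definition np_wrgmm_param ::
  "nat \<Rightarrow> (nat \<Rightarrow> real) \<Rightarrow> (nat \<Rightarrow> nat \<Rightarrow> 'a::euclidean_space measure) \<Rightarrow> bool" where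
  "np_wrgmm_param Q \<pi> \<mu> \<longleftrightarrow>
     (\<forall>q\<in>{1..Q}. 0 < \<pi> q \<and> \<pi> q < 1) \<and> (\<Sum>q=1..Q. \<pi> q) = 1 \<and>
     (\<forall>q\<in>{1..Q}. \<forall>l\<in>{1..Q}. \<mu> q l = \<mu> l q \<and> np_edge_law (\<mu> q l))"

definition measures_lin_indep ::
  "nat \<Rightarrow> (nat \<Rightarrow> nat \<Rightarrow> 'a::euclidean_space measure) \<Rightarrow> bool" where
  "measures_lin_indep Q \<mu> \<longleftrightarrow>
     (\<forall>c :: nat \<Rightarrow> nat \<Rightarrow> real.
        (\<forall>A\<in>sets borel. (\<Sum>(q, l)\<in>{(q, l). 1 \<le> q \<and> q \<le> l \<and> l \<le> Q}. c q l * measure (\<mu> q l) A) = 0)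
        \<longrightarrow> (\<forall>q l. 1 \<le> q \<and> q \<le> l \<and> l \<le> Q \<longrightarrow> c q l = 0))"

text \<open>Joint distribution of the edge variables of K_n: Z_i i.i.d. with law pi on {1..Q},
  and given Z the X_ij (i<j) independent with laws mu_{Z_i Z_j}.\<close>
definition joint_law ::
  "nat \<Rightarrow> (nat \<Rightarrow> real) \<Rightarrow> (nat \<Rightarrow> nat \<Rightarrow> 'a::euclidean_space measure) \<Rightarrow> nat
     \<Rightarrow> (nat \<times> nat \<Rightarrow> 'a) set \<Rightarrow> real" where
  "joint_law Q \<pi> \<mu> n A =
     (\<Sum>z\<in>{..<n} \<rightarrow>\<^sub>E {1..Q}. (\<Prod>i<n. \<pi> (z i)) *
        measure (PiM (edges n) (\<lambda>e. \<mu> (z (fst e)) (z (snd e)))) A)"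

end

theory Submission
  imports Defs
begin

(* Write m_q(A) = sum_l pi_l mu_ql(A) for the law of an edge variable seen from a node of
   group q (the "group marginal").  Three edges at a common node have joint probabilities
   sum_q pi_q m_q(A) m_q(B) m_q(C), a symmetric third-order tensor, and a path 2-0-1-3 has
   joint probabilities sum_{q,l} pi_q pi_l mu_ql(A) m_q(B) m_l(C).  Only four nodes are
   involved, so the law of K_9 determines both expressions.

   Linear independence of the mu_ql (q <= l) and positivity of pi make the m_q linearly
   independent, hence they admit a dual family of finite combinations of point evaluations.
   Contracting the tensor with such duals shows that a third-moment decomposition with
   linearly independent components normalised by m_q(UNIV) = 1 is unique up to relabelling;
   contracting the path expression with the same duals then recovers every pi_q pi_l mu_ql. *)

subsection \<open>Finite combinations of point evaluations\<close>

text \<open>A list of weighted points represents the linear functional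
  \<open>F \<mapsto> \<Sum> c * F x\<close> on real functions; it is the only kind of linear functional
  needed to separate finitely many linearly independent functions.\<close>
definition eval_comb :: "(real \<times> 'b) list \<Rightarrow> ('b \<Rightarrow> real) \<Rightarrow> real" where
  "eval_comb g F = (\<Sum>p\<leftarrow>g. fst p * F (snd p))"

definition comb_points :: "(real \<times> 'b) list \<Rightarrow> 'b set" where
  "comb_points g = snd ` set g"

definition scale_comb :: "real \<Rightarrow> (real \<times> 'b) list \<Rightarrow> (real \<times> 'b) list" where
  "scale_comb s g = map (\<lambda>p. (s * fst p, snd p)) g"

lemma eval_comb_Nil [simp]: "eval_comb [] F = 0"
  by (simp add: eval_comb_def)

lemma eval_comb_Cons [simp]: "eval_comb (p # g) F = fst p * F (snd p) + eval_comb g F"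
  by (simp add: eval_comb_def)

lemma eval_comb_append [simp]: "eval_comb (g @ g') F = eval_comb g F + eval_comb g' F"
  by (simp add: eval_comb_def)

lemma eval_comb_scale [simp]: "eval_comb (scale_comb s g) F = s * eval_comb g F"
  by (induction g) (auto simp: scale_comb_def algebra_simps)

lemma eval_comb_concat: "eval_comb (concat (map G ks)) F = (\<Sum>k\<leftarrow>ks. eval_comb (G k) F)"
  by (induction ks) auto

lemma comb_points_Cons [simp]: "comb_points (p # g) = insert (snd p) (comb_points g)"
  and comb_points_append [simp]: "comb_points (g @ g') = comb_points g \<union> comb_points g'"
  and comb_points_scale [simp]: "comb_points (scale_comb s g) = comb_points g"
  and comb_points_concat: "comb_points (concat (map G ks)) = (\<Union>k\<in>set ks. comb_points (G k))"
  by (force simp: comb_points_def scale_comb_def)+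

lemma eval_comb_sum: "eval_comb g (\<lambda>x. \<Sum>i\<in>I. F i x) = (\<Sum>i\<in>I. eval_comb g (F i))"
  by (induction g) (auto simp: sum.distrib sum_distrib_left)

lemma eval_comb_cmult: "eval_comb g (\<lambda>x. c * F x) = c * eval_comb g F"
  and eval_comb_multc: "eval_comb g (\<lambda>x. F x * c) = eval_comb g F * c"
  by (induction g) (auto simp: algebra_simps)

lemmas eval_comb_linear = eval_comb_sum eval_comb_cmult eval_comb_multc

lemma eval_comb_cong:
  assumes "comb_points g \<subseteq> X" and "\<And>x. x \<in> X \<Longrightarrow> F x = G x"
  shows "eval_comb g F = eval_comb g G"
  using assms by (induction g) auto

lemma eval_comb2_cong:
  assumes "comb_points u \<subseteq> X" "comb_points v \<subseteq> X"
    and "\<And>B C. B \<in> X \<Longrightarrow> C \<in> X \<Longrightarrow> \<Phi> B C = \<Psi> B C"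
  shows "eval_comb u (\<lambda>B. eval_comb v (\<Phi> B)) = eval_comb u (\<lambda>B. eval_comb v (\<Psi> B))"
  using assms by (intro eval_comb_cong[OF assms(1)] eval_comb_cong[OF assms(2)]) auto

subsection \<open>Linear independence and dual families\<close>

definition lin_indep_on :: "'b set \<Rightarrow> 'i set \<Rightarrow> ('i \<Rightarrow> 'b \<Rightarrow> real) \<Rightarrow> bool" where
  "lin_indep_on X I f \<longleftrightarrow> (\<forall>c. (\<forall>x\<in>X. (\<Sum>i\<in>I. c i * f i x) = 0) \<longrightarrow> (\<forall>i\<in>I. c i = 0))"

definition dual_family ::
  "'b set \<Rightarrow> 'i set \<Rightarrow> ('i \<Rightarrow> 'b \<Rightarrow> real) \<Rightarrow> ('i \<Rightarrow> (real \<times> 'b) list) \<Rightarrow> bool" where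
  "dual_family X I f g \<longleftrightarrow>
     (\<forall>k\<in>I. comb_points (g k) \<subseteq> X \<and> (\<forall>i\<in>I. eval_comb (g k) (f i) = (if i = k then 1 else 0)))"

lemma lin_indep_onD:
  assumes "lin_indep_on X I f" "\<And>x. x \<in> X \<Longrightarrow> (\<Sum>i\<in>I. c i * f i x) = 0" "i \<in> I"
  shows "c i = 0"
  using assms unfolding lin_indep_on_def by blast

lemma lin_indep_on_subset:
  assumes "lin_indep_on X I f" "J \<subseteq> I" "finite I"
  shows "lin_indep_on X J f"
  unfolding lin_indep_on_def
proof (intro allI impI ballI)
  fix c j assume vanish: "\<forall>x\<in>X. (\<Sum>i\<in>J. c i * f i x) = 0" and j: "j \<in> J"
  let ?c = "\<lambda>i. if i \<in> J then c i else 0"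
  have extend: "(\<Sum>i\<in>I. ?c i * f i x) = (\<Sum>i\<in>J. c i * f i x)" for x
    using assms(2,3) by (intro sum.mono_neutral_cong_right) auto
  have "?c j = 0"
    by (rule lin_indep_onD[OF assms(1)]) (use extend vanish j assms(2) in auto)
  then show "c j = 0" using j by simp
qed

lemma eval_dual_comb:
  assumes "dual_family X I f g" "finite I" "k \<in> I"
  shows "eval_comb (g k) (\<lambda>x. \<Sum>i\<in>I. c i * f i x) = c k"
proof -
  have "eval_comb (g k) (\<lambda>x. \<Sum>i\<in>I. c i * f i x) = (\<Sum>i\<in>I. c i * eval_comb (g k) (f i))"
    by (simp add: eval_comb_sum eval_comb_cmult)
  also have "\<dots> = (\<Sum>i\<in>I. if i = k then c i else 0)"
    using assms(1,3) by (intro sum.cong) (auto simp: dual_family_def)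
  finally show ?thesis using assms(2,3) by simp
qed

text \<open>Inductive step for the existence of duals: if \<open>f a\<close> is independent of the \<open>f k\<close>,
  \<open>k \<in> J\<close>, its residual after subtracting the dual projection does not vanish on \<open>X\<close>.\<close>
lemma dual_residual_nonzero:
  assumes indep: "lin_indep_on X (insert a J) f" and "a \<notin> J" "finite J"
    and g: "dual_family X J f g"
  shows "\<exists>x\<in>X. f a x - (\<Sum>k\<in>J. eval_comb (g k) (f a) * f k x) \<noteq> 0"
proof (rule ccontr)
  assume "\<not> ?thesis"
  then have vanish: "f a x - (\<Sum>k\<in>J. eval_comb (g k) (f a) * f k x) = 0" if "x \<in> X" for x
    using that by blast
  let ?c = "\<lambda>i. if i = a then 1 else - eval_comb (g i) (f a)"
  have "(\<Sum>i\<in>J. ?c i * f i x) = (\<Sum>k\<in>J. - (eval_comb (g k) (f a) * f k x))" for x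
    using assms(2) by (intro sum.cong) auto
  then have "(\<Sum>i\<in>insert a J. ?c i * f i x) = f a x - (\<Sum>k\<in>J. eval_comb (g k) (f a) * f k x)" for x
    using assms(2,3) by (simp add: sum_negf)
  then have "?c a = 0"
    using lin_indep_onD[OF indep, of ?c a] vanish by simp
  then show False by simp
qed

lemma dual_family_exists:
  assumes "finite I" "lin_indep_on X I f"
  shows "\<exists>g. dual_family X I f g"
  using assms
proof (induction I rule: finite_induct)
  case empty
  show ?case by (simp add: dual_family_def)
next
  case (insert a J)
  obtain g where g: "dual_family X J f g"
    using insert lin_indep_on_subset[OF insert.prems] by blast
  define res where "res x = f a x - (\<Sum>k\<in>J. eval_comb (g k) (f a) * f k x)" for x
  obtain x0 where x0: "x0 \<in> X" "res x0 \<noteq> 0"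
    using dual_residual_nonzero[OF insert.prems insert.hyps(2,1) g] by (auto simp: res_def)
  obtain ks where ks: "set ks = J" "distinct ks"
    using finite_distinct_list[OF insert.hyps(1)] by blast
  text \<open>\<open>ga\<close> evaluates \<open>F\<close> at \<open>x0\<close> after removing its projection onto the \<open>f k\<close>, \<open>k \<in> J\<close>.\<close>
  define ga where "ga = scale_comb (1 / res x0)
      ((1, x0) # concat (map (\<lambda>k. scale_comb (- f k x0) (g k)) ks))"
  have eval_ga: "eval_comb ga F = (F x0 - (\<Sum>k\<in>J. f k x0 * eval_comb (g k) F)) / res x0" for F
    using ks by (simp add: ga_def eval_comb_concat sum_list_distinct_conv_sum_set sum_negf)
  have ga_J: "eval_comb ga (f i) = 0" if "i \<in> J" for i
  proof -
    have "(\<Sum>k\<in>J. f k x0 * eval_comb (g k) (f i)) = (\<Sum>k\<in>J. if k = i then f k x0 else 0)"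
      using g that by (intro sum.cong) (auto simp: dual_family_def)
    then show ?thesis using that insert.hyps(1) by (simp add: eval_ga)
  qed
  have ga_a: "eval_comb ga (f a) = 1"
    using x0 by (simp add: eval_ga res_def mult.commute)
  have ga_X: "comb_points ga \<subseteq> X"
    using x0 g ks by (auto simp: ga_def comb_points_concat dual_family_def)
  define g' where "g' k = (if k = a then ga else g k @ scale_comb (- eval_comb (g k) (f a)) ga)" for k
  have "eval_comb (g' k) (f i) = (if i = k then 1 else 0)" if "k \<in> insert a J" "i \<in> insert a J" for k i
    using that ga_J ga_a g insert.hyps(2) by (auto simp: g'_def dual_family_def)
  moreover have "comb_points (g' k) \<subseteq> X" if "k \<in> insert a J" for k
    using that ga_X g by (auto simp: g'_def dual_family_def)
  ultimately show ?case unfolding dual_family_def by blast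
qed

lemma lin_indep_on_reindex_inj:
  assumes "finite S" and indep: "lin_indep_on X S h" and h: "\<And>j A. j \<in> S \<Longrightarrow> A \<in> X \<Longrightarrow> h j A = f (\<sigma> j) A"
  shows "inj_on \<sigma> S"
proof (rule inj_onI, rule ccontr)
  fix j j' assume jj: "j \<in> S" "j' \<in> S" "\<sigma> j = \<sigma> j'" "j \<noteq> j'"
  let ?c = "\<lambda>i. if i = j then 1 else if i = j' then -1 else (0::real)"
  have "(\<Sum>i\<in>S. ?c i * h i A) = 0" if "A \<in> X" for A
  proof -
    have "(\<Sum>i\<in>S. ?c i * h i A) = (\<Sum>i\<in>{j, j'}. ?c i * h i A)"
      using jj \<open>finite S\<close> by (intro sum.mono_neutral_cong_right) auto
    also have "\<dots> = h j A - h j' A" using jj(4) by simp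
    finally show ?thesis using h[OF jj(1) that] h[OF jj(2) that] jj(3) by simp
  qed
  then have "?c j = 0" using lin_indep_onD[OF indep, of ?c j] jj(1) by blast
  then show False by simp
qed

subsection \<open>Uniqueness of third-moment decompositions with independent components\<close>

context
  fixes S :: "'i set" and X :: "'b set" and f h :: "'i \<Rightarrow> 'b \<Rightarrow> real" and \<pi> \<pi>' :: "'i \<Rightarrow> real"
  assumes finite_S: "finite S"
    and moments_eq: "\<And>A B C. A \<in> X \<Longrightarrow> B \<in> X \<Longrightarrow> C \<in> X \<Longrightarrow>
      (\<Sum>i\<in>S. \<pi> i * f i A * f i B * f i C) = (\<Sum>j\<in>S. \<pi>' j * h j A * h j B * h j C)"
begin

lemma contracted_moments_eq:
  assumes "A \<in> X" "comb_points u \<subseteq> X" "comb_points v \<subseteq> X"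
  shows "(\<Sum>i\<in>S. \<pi> i * f i A * eval_comb u (f i) * eval_comb v (f i)) =
         (\<Sum>j\<in>S. \<pi>' j * h j A * eval_comb u (h j) * eval_comb v (h j))"
proof -
  have "(\<Sum>i\<in>S. \<pi> i * f i A * eval_comb u (f i) * eval_comb v (f i)) =
      eval_comb u (\<lambda>B. eval_comb v (\<lambda>C. \<Sum>i\<in>S. \<pi> i * f i A * f i B * f i C))"
    by (simp add: eval_comb_linear mult_ac)
  also have "\<dots> = eval_comb u (\<lambda>B. eval_comb v (\<lambda>C. \<Sum>j\<in>S. \<pi>' j * h j A * h j B * h j C))"
    using assms moments_eq by (intro eval_comb2_cong) auto
  also have "\<dots> = (\<Sum>j\<in>S. \<pi>' j * h j A * eval_comb u (h j) * eval_comb v (h j))"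
    by (simp add: eval_comb_linear mult_ac)
  finally show ?thesis .
qed

text \<open>Contracting with a dual of the second family shows that each \<open>h j\<close> is a linear
  combination of the \<open>f i\<close>.\<close>
lemma components_in_span:
  assumes indep_h: "lin_indep_on X S h" and nz: "\<And>j. j \<in> S \<Longrightarrow> \<pi>' j \<noteq> 0"
  shows "\<exists>c. \<forall>j\<in>S. \<forall>A\<in>X. h j A = (\<Sum>i\<in>S. c i j * f i A)"
proof -
  obtain g' where g': "dual_family X S h g'"
    using dual_family_exists[OF finite_S indep_h] by blast
  define c where "c i j = \<pi> i * (eval_comb (g' j) (f i))\<^sup>2 / \<pi>' j" for i j
  have "h j A = (\<Sum>i\<in>S. c i j * f i A)" if j: "j \<in> S" and A: "A \<in> X" for j A
  proof -
    have "(\<Sum>j'\<in>S. \<pi>' j' * h j' A * eval_comb (g' j) (h j') * eval_comb (g' j) (h j')) =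
        (\<Sum>j'\<in>S. if j' = j then \<pi>' j' * h j' A else 0)"
      using g' j by (intro sum.cong) (auto simp: dual_family_def)
    also have "\<dots> = \<pi>' j * h j A" using finite_S j by simp
    finally have "\<pi>' j * h j A = (\<Sum>i\<in>S. \<pi> i * f i A * (eval_comb (g' j) (f i))\<^sup>2)"
      using contracted_moments_eq[OF A, of "g' j" "g' j"] g' j
      by (simp add: dual_family_def power2_eq_square mult.assoc)
    then have "h j A = (\<Sum>i\<in>S. \<pi> i * f i A * (eval_comb (g' j) (f i))\<^sup>2) / \<pi>' j"
      using nz[OF j] by (simp add: eq_divide_eq mult.commute)
    then show ?thesis by (simp add: c_def sum_divide_distrib mult_ac)
  qed
  then show ?thesis by blast
qed

text \<open>Contracting with a dual of the first family shows that no \<open>h j\<close> can involve two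
  different \<open>f i\<close>.\<close>
lemma span_coefficients_disjoint:
  assumes indep_f: "lin_indep_on X S f" and indep_h: "lin_indep_on X S h"
    and nz: "\<And>j. j \<in> S \<Longrightarrow> \<pi>' j \<noteq> 0"
    and span: "\<And>j A. j \<in> S \<Longrightarrow> A \<in> X \<Longrightarrow> h j A = (\<Sum>i\<in>S. c i j * f i A)"
    and kl: "k \<in> S" "l \<in> S" "k \<noteq> l" and j: "j \<in> S"
  shows "c k j * c l j = 0"
proof -
  obtain g where g: "dual_family X S f g"
    using dual_family_exists[OF finite_S indep_f] by blast
  have pts: "comb_points (g i) \<subseteq> X" if "i \<in> S" for i
    using g that by (simp add: dual_family_def)
  have coeff: "eval_comb (g i) (h j') = c i j'" if "i \<in> S" "j' \<in> S" for i j'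
  proof -
    have "eval_comb (g i) (h j') = eval_comb (g i) (\<lambda>A. \<Sum>i'\<in>S. c i' j' * f i' A)"
      using span that by (intro eval_comb_cong[OF pts]) auto
    then show ?thesis using eval_dual_comb[OF g finite_S that(1)] by simp
  qed
  have "(\<Sum>j'\<in>S. (\<pi>' j' * c k j' * c l j') * h j' A) = 0" if A: "A \<in> X" for A
  proof -
    have "(\<Sum>j'\<in>S. (\<pi>' j' * c k j' * c l j') * h j' A) =
        (\<Sum>j'\<in>S. \<pi>' j' * h j' A * eval_comb (g k) (h j') * eval_comb (g l) (h j'))"
      using coeff kl by (intro sum.cong) (auto simp: mult_ac)
    also have "\<dots> = (\<Sum>i\<in>S. \<pi> i * f i A * eval_comb (g k) (f i) * eval_comb (g l) (f i))"
      using contracted_moments_eq[OF A pts pts] kl by simp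
    also have "\<dots> = 0"
      using g kl by (intro sum.neutral) (auto simp: dual_family_def)
    finally show ?thesis .
  qed
  then have "\<pi>' j * c k j * c l j = 0"
    using lin_indep_onD[OF indep_h, of "\<lambda>j'. \<pi>' j' * c k j' * c l j'" j] j by blast
  then show ?thesis using nz[OF j] by simp
qed

lemma components_match:
  assumes indep_f: "lin_indep_on X S f" and indep_h: "lin_indep_on X S h"
    and nz: "\<And>j. j \<in> S \<Longrightarrow> \<pi>' j \<noteq> 0"
    and U: "U \<in> X" "\<And>i. i \<in> S \<Longrightarrow> f i U = 1" "\<And>j. j \<in> S \<Longrightarrow> h j U = 1"
  shows "\<exists>\<sigma>. \<forall>j\<in>S. \<sigma> j \<in> S \<and> (\<forall>A\<in>X. h j A = f (\<sigma> j) A)"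
proof -
  obtain c where span: "\<And>j A. j \<in> S \<Longrightarrow> A \<in> X \<Longrightarrow> h j A = (\<Sum>i\<in>S. c i j * f i A)"
    using components_in_span[OF indep_h nz] by blast
  have "\<exists>k\<in>S. \<forall>A\<in>X. h j A = f k A" if j: "j \<in> S" for j
  proof -
    obtain k where k: "k \<in> S" "c k j \<noteq> 0"
      using span[OF j U(1)] U(2,3)[OF j] by (metis (no_types, lifting) mult_eq_0_iff sum.neutral zero_neq_one)
    have single: "h j A = c k j * f k A" if A: "A \<in> X" for A
    proof -
      have "c i j = 0" if "i \<in> S" "i \<noteq> k" for i
        using span_coefficients_disjoint[OF indep_f indep_h nz span k(1) that(1) _ j] that k by auto
      then have "(\<Sum>i\<in>S. c i j * f i A) = (\<Sum>i\<in>S. if i = k then c i j * f i A else 0)"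
        by (intro sum.cong) auto
      then show ?thesis using span[OF j A] finite_S k(1) by simp
    qed
    have "c k j = 1" using single[OF U(1)] U(2)[OF k(1)] U(3)[OF j] by simp
    then show ?thesis using single k(1) by auto
  qed
  then show ?thesis by metis
qed

lemma weights_match:
  assumes indep_f: "lin_indep_on X S f"
    and \<sigma>: "\<And>j. j \<in> S \<Longrightarrow> \<sigma> j \<in> S" "inj_on \<sigma> S"
    and h: "\<And>j A. j \<in> S \<Longrightarrow> A \<in> X \<Longrightarrow> h j A = f (\<sigma> j) A"
    and U: "U \<in> X" "\<And>i. i \<in> S \<Longrightarrow> f i U = 1" and j: "j \<in> S"
  shows "\<pi>' j = \<pi> (\<sigma> j)"
proof -
  obtain g where g: "dual_family X S f g"
    using dual_family_exists[OF finite_S indep_f] by blast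
  let ?k = "\<sigma> j"
  have k: "?k \<in> S" using \<sigma>(1)[OF j] .
  have pts: "comb_points (g ?k) \<subseteq> X" using g k by (simp add: dual_family_def)
  have "(\<Sum>i\<in>S. \<pi> i * f i U * eval_comb (g ?k) (f i) * eval_comb (g ?k) (f i)) =
      (\<Sum>i\<in>S. if i = ?k then \<pi> i else 0)"
    using g k U by (intro sum.cong) (auto simp: dual_family_def)
  also have "\<dots> = \<pi> ?k" using finite_S k by simp
  finally have lhs: "(\<Sum>i\<in>S. \<pi> i * f i U * eval_comb (g ?k) (f i) * eval_comb (g ?k) (f i)) = \<pi> ?k" .
  have "eval_comb (g ?k) (h j') = (if j' = j then 1 else 0)" if j': "j' \<in> S" for j'
  proof -
    have "eval_comb (g ?k) (h j') = eval_comb (g ?k) (f (\<sigma> j'))"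
      using h j' by (intro eval_comb_cong[OF pts]) auto
    also have "\<dots> = (if \<sigma> j' = ?k then 1 else 0)" using g k \<sigma>(1)[OF j'] by (simp add: dual_family_def)
    finally show ?thesis using \<sigma>(2) j j' by (auto dest: inj_onD)
  qed
  then have "(\<Sum>j'\<in>S. \<pi>' j' * h j' U * eval_comb (g ?k) (h j') * eval_comb (g ?k) (h j')) =
      (\<Sum>j'\<in>S. if j' = j then \<pi>' j' else 0)"
    using h U \<sigma>(1) by (intro sum.cong) auto
  also have "\<dots> = \<pi>' j" using finite_S j by simp
  finally show ?thesis using lhs contracted_moments_eq[OF U(1) pts pts] by simp
qed

theorem third_moment_decomposition_unique:
  assumes indep_f: "lin_indep_on X S f" and indep_h: "lin_indep_on X S h"
    and nz: "\<And>j. j \<in> S \<Longrightarrow> \<pi>' j \<noteq> 0"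
    and U: "U \<in> X" "\<And>i. i \<in> S \<Longrightarrow> f i U = 1" "\<And>j. j \<in> S \<Longrightarrow> h j U = 1"
  shows "\<exists>\<sigma>. (\<forall>j\<in>S. \<sigma> j \<in> S) \<and> inj_on \<sigma> S \<and>
           (\<forall>j\<in>S. \<pi>' j = \<pi> (\<sigma> j) \<and> (\<forall>A\<in>X. h j A = f (\<sigma> j) A))"
proof -
  obtain \<sigma> where \<sigma>: "\<And>j. j \<in> S \<Longrightarrow> \<sigma> j \<in> S" "\<And>j A. j \<in> S \<Longrightarrow> A \<in> X \<Longrightarrow> h j A = f (\<sigma> j) A"
    using components_match[OF indep_f indep_h nz U] by metis
  have inj: "inj_on \<sigma> S"
    using lin_indep_on_reindex_inj[OF finite_S indep_h, where f=f and \<sigma>=\<sigma>] \<sigma>(2) by blast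
  show ?thesis
    using \<sigma> inj weights_match[OF indep_f \<sigma>(1) inj \<sigma>(2) U(1,2)] by blast
qed

end

subsection \<open>Edge laws and group marginals\<close>

lemma np_edge_law_prob_space:
  assumes "np_edge_law m"
  shows "prob_space m" "sets m = sets borel" "space m = UNIV"
  using assms sets_eq_imp_space_eq[of m borel] by (auto simp: np_edge_law_def)

lemma np_edge_law_eqI:
  assumes m: "np_edge_law m" and m': "np_edge_law m'"
    and eq: "\<And>A. A \<in> sets borel \<Longrightarrow> measure m A = measure m' A"
  shows "m = m'"
proof (rule measure_eqI)
  show sets_eq: "sets m = sets m'" using np_edge_law_prob_space(2)[OF m] np_edge_law_prob_space(2)[OF m'] by simp
  fix A assume "A \<in> sets m"
  then have "A \<in> sets borel" using np_edge_law_prob_space(2)[OF m] by simp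
  then show "emeasure m A = emeasure m' A"
    using eq finite_measure.emeasure_eq_measure[OF prob_space.finite_measure, OF np_edge_law_prob_space(1)]
      m m' by metis
qed

lemma np_wrgmm_param_edge_law:
  "np_wrgmm_param Q \<pi> \<mu> \<Longrightarrow> q \<in> {1..Q} \<Longrightarrow> l \<in> {1..Q} \<Longrightarrow> np_edge_law (\<mu> q l)"
  by (simp add: np_wrgmm_param_def)

text \<open>The law of an edge variable \<open>X_ij\<close> given only \<open>Z_i = q\<close>: the group of \<open>j\<close> is averaged out.\<close>
definition group_marginal ::
  "nat \<Rightarrow> (nat \<Rightarrow> real) \<Rightarrow> (nat \<Rightarrow> nat \<Rightarrow> 'a::euclidean_space measure) \<Rightarrow> nat \<Rightarrow> 'a set \<Rightarrow> real" where
  "group_marginal Q \<pi> \<mu> q A = (\<Sum>l\<in>{1..Q}. \<pi> l * measure (\<mu> q l) A)"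

lemma group_marginal_UNIV:
  assumes P: "np_wrgmm_param Q \<pi> \<mu>" and q: "q \<in> {1..Q}"
  shows "group_marginal Q \<pi> \<mu> q UNIV = 1"
proof -
  have "measure (\<mu> q l) UNIV = 1" if "l \<in> {1..Q}" for l
    using np_edge_law_prob_space[OF np_wrgmm_param_edge_law[OF P q that]] prob_space.prob_space by metis
  then have "group_marginal Q \<pi> \<mu> q UNIV = (\<Sum>l\<in>{1..Q}. \<pi> l)"
    unfolding group_marginal_def by (intro sum.cong) auto
  then show ?thesis using P by (simp add: np_wrgmm_param_def)
qed

lemma sum_square_symmetric:
  fixes w F :: "nat \<Rightarrow> nat \<Rightarrow> real"
  assumes sym: "\<And>q l. q \<in> {1..Q} \<Longrightarrow> l \<in> {1..Q} \<Longrightarrow> F q l = F l q"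
  shows "(\<Sum>q\<in>{1..Q}. \<Sum>l\<in>{1..Q}. w q l * F q l) =
    (\<Sum>(q, l)\<in>{(q, l). 1 \<le> q \<and> q \<le> l \<and> l \<le> Q}. (if q = l then w q l else w q l + w l q) * F q l)"
proof -
  let ?P = "{(q, l). 1 \<le> q \<and> q \<le> l \<and> l \<le> Q}"
  let ?L = "{(q, l). 1 \<le> q \<and> q < l \<and> l \<le> Q}"
  have fin: "finite ?P" "finite ?L"
    by (rule finite_subset[of _ "{1..Q} \<times> {1..Q}"]; auto)+
  have "(\<Sum>q\<in>{1..Q}. \<Sum>l\<in>{1..Q}. w q l * F q l) = (\<Sum>(q, l)\<in>?P \<union> prod.swap ` ?L. w q l * F q l)"
    by (simp add: sum.cartesian_product) (intro sum.cong; force)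
  also have "\<dots> = (\<Sum>(q, l)\<in>?P. w q l * F q l) + (\<Sum>(q, l)\<in>?L. w l q * F q l)"
    using fin sym by (subst sum.union_disjoint) (auto simp: sum.reindex intro!: sum.cong)
  also have "(\<Sum>(q, l)\<in>?L. w l q * F q l) = (\<Sum>(q, l)\<in>?P. (if q = l then 0 else w l q) * F q l)"
    by (rule sum.mono_neutral_cong_left[OF fin(1)]) (auto split: if_splits)
  finally show ?thesis
    by (simp add: sum.distrib[symmetric] split_def) (intro sum.cong; simp add: distrib_right)
qed

text \<open>Linear independence of the \<open>\<mu> q l\<close> (\<open>q \<le> l\<close>) passes to the group marginals, because
  the weights \<open>\<pi>\<close> are positive.\<close>
lemma group_marginals_lin_indep:
  assumes P: "np_wrgmm_param Q \<pi> \<mu>" and L: "measures_lin_indep Q \<mu>"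
  shows "lin_indep_on (sets borel) {1..Q} (group_marginal Q \<pi> \<mu>)"
  unfolding lin_indep_on_def
proof (intro allI impI ballI)
  fix c i assume vanish: "\<forall>A\<in>sets borel. (\<Sum>i\<in>{1..Q}. c i * group_marginal Q \<pi> \<mu> i A) = 0"
    and i: "i \<in> {1..Q}"
  define d where "d q l = (if q = l then c q * \<pi> l else c q * \<pi> l + c l * \<pi> q)" for q l
  have "(\<Sum>(q, l)\<in>{(q, l). 1 \<le> q \<and> q \<le> l \<and> l \<le> Q}. d q l * measure (\<mu> q l) A) = 0"
    if A: "A \<in> sets borel" for A
  proof -
    have "(\<Sum>(q, l)\<in>{(q, l). 1 \<le> q \<and> q \<le> l \<and> l \<le> Q}. d q l * measure (\<mu> q l) A) =
       (\<Sum>q\<in>{1..Q}. \<Sum>l\<in>{1..Q}. (c q * \<pi> l) * measure (\<mu> q l) A)"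
      unfolding d_def using P
      by (intro sum_square_symmetric[symmetric]) (auto simp: np_wrgmm_param_def)
    also have "\<dots> = (\<Sum>i\<in>{1..Q}. c i * group_marginal Q \<pi> \<mu> i A)"
      by (simp add: group_marginal_def sum_distrib_left mult_ac)
    finally show ?thesis using vanish A by simp
  qed
  then have "d i i = 0" using L i unfolding measures_lin_indep_def by auto
  moreover have "\<pi> i > 0" using P i by (simp add: np_wrgmm_param_def)
  ultimately show "c i = 0" by (simp add: d_def)
qed

subsection \<open>The joint law on edge cylinders\<close>

definition edge_cylinder ::
  "nat \<Rightarrow> (nat \<times> nat) set \<Rightarrow> (nat \<times> nat \<Rightarrow> 'a set) \<Rightarrow> (nat \<times> nat \<Rightarrow> 'a::euclidean_space) set" where
  "edge_cylinder n J Y = prod_emb (edges n) (\<lambda>_. borel) J (Pi\<^sub>E J Y)"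

lemma finite_edges: "finite (edges n)"
  by (rule finite_subset[of _ "{..<n} \<times> {..<n}"]) (auto simp: edges_def)

lemma edges_mono: "m \<le> n \<Longrightarrow> edges m \<subseteq> edges n"
  by (auto simp: edges_def)

lemma edge_cylinder_measurable:
  assumes "J \<subseteq> edges n" "\<And>e. e \<in> J \<Longrightarrow> Y e \<in> sets borel"
  shows "edge_cylinder n J Y \<in> sets (PiM (edges n) (\<lambda>_. (borel :: 'a::euclidean_space measure)))"
  unfolding edge_cylinder_def
  using assms finite_subset[OF assms(1) finite_edges] by (intro sets_PiM_I) auto

text \<open>Conditionally on the groups, the edge variables are independent, so the probability of
  a cylinder is a mixture of products of edge probabilities.\<close>
lemma joint_law_edge_cylinder:
  fixes \<mu> :: "nat \<Rightarrow> nat \<Rightarrow> 'a::euclidean_space measure"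
  assumes P: "np_wrgmm_param Q \<pi> \<mu>" and J: "J \<subseteq> edges n"
    and Y: "\<And>e. e \<in> J \<Longrightarrow> Y e \<in> sets borel"
  shows "joint_law Q \<pi> \<mu> n (edge_cylinder n J Y) =
    (\<Sum>z\<in>{..<n} \<rightarrow>\<^sub>E {1..Q}. (\<Prod>i<n. \<pi> (z i)) *
        (\<Prod>e\<in>J. measure (\<mu> (z (fst e)) (z (snd e))) (Y e)))"
  unfolding joint_law_def
proof (rule sum.cong[OF refl])
  fix z assume z: "z \<in> {..<n} \<rightarrow>\<^sub>E {1..Q}"
  let ?M = "\<lambda>e. \<mu> (z (fst e)) (z (snd e))"
  have law: "np_edge_law (?M e)" if "e \<in> edges n" for e
    using that PiE_mem[OF z] by (intro np_wrgmm_param_edge_law[OF P]) (auto simp: edges_def)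
  note facts = np_edge_law_prob_space[OF law]
  have "edge_cylinder n J Y = prod_emb (edges n) ?M J (Pi\<^sub>E J Y)"
    using facts(3) by (auto simp: edge_cylinder_def prod_emb_def)
  then have "emeasure (PiM (edges n) ?M) (edge_cylinder n J Y) = (\<Prod>e\<in>J. emeasure (?M e) (Y e))"
    using facts(1,2) J Y finite_subset[OF J finite_edges]
    by (simp add: emeasure_PiM_emb prob_space_imp_sigma_finite subset_eq)
  also have "\<dots> = ennreal (\<Prod>e\<in>J. measure (?M e) (Y e))"
    using facts(1) J
    by (simp add: prod_ennreal[symmetric] finite_measure.emeasure_eq_measure[OF prob_space.finite_measure] subset_eq)
  finally have "measure (PiM (edges n) ?M) (edge_cylinder n J Y) = (\<Prod>e\<in>J. measure (?M e) (Y e))"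
    by (simp add: measure_def prod_nonneg)
  then show "(\<Prod>i<n. \<pi> (z i)) * measure (PiM (edges n) ?M) (edge_cylinder n J Y) =
     (\<Prod>i<n. \<pi> (z i)) * (\<Prod>e\<in>J. measure (?M e) (Y e))" by simp
qed

lemma sum_PiE_insert:
  assumes "x \<notin> I"
  shows "(\<Sum>z\<in>insert x I \<rightarrow>\<^sub>E S. F z) = (\<Sum>z\<in>I \<rightarrow>\<^sub>E S. \<Sum>s\<in>S. F (z(x := s)))"
proof -
  have "(\<Sum>z\<in>insert x I \<rightarrow>\<^sub>E S. F z) = (\<Sum>(s, z)\<in>S \<times> (I \<rightarrow>\<^sub>E S). F (z(x := s)))"
    unfolding PiE_insert_eq
    by (subst sum.reindex[OF inj_combinator[OF assms]]) (simp add: comp_def case_prod_unfold)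
  also have "\<dots> = (\<Sum>s\<in>S. \<Sum>z\<in>I \<rightarrow>\<^sub>E S. F (z(x := s)))"
    by (simp add: sum.cartesian_product)
  also have "\<dots> = (\<Sum>z\<in>I \<rightarrow>\<^sub>E S. \<Sum>s\<in>S. F (z(x := s)))"
    by (rule sum.swap)
  finally show ?thesis .
qed

text \<open>Latent groups of nodes not involved in an event can be summed out, since \<open>\<pi>\<close> is a
  probability vector.\<close>
lemma sum_unused_latent:
  fixes \<pi> :: "'s \<Rightarrow> real" and m n :: nat
  assumes one: "(\<Sum>s\<in>S. \<pi> s) = 1" and "m \<le> n"
    and G: "\<And>z z'. (\<And>i. i < m \<Longrightarrow> z i = z' i) \<Longrightarrow> G z = G z'"
  shows "(\<Sum>z\<in>{..<n} \<rightarrow>\<^sub>E S. (\<Prod>i<n. \<pi> (z i)) * G z) =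
         (\<Sum>z\<in>{..<m} \<rightarrow>\<^sub>E S. (\<Prod>i<m. \<pi> (z i)) * G z)"
  using \<open>m \<le> n\<close>
proof (induction n rule: dec_induct)
  case base
  show ?case ..
next
  case (step n)
  have "(\<Sum>z\<in>{..<Suc n} \<rightarrow>\<^sub>E S. (\<Prod>i<Suc n. \<pi> (z i)) * G z) =
      (\<Sum>z\<in>{..<n} \<rightarrow>\<^sub>E S. \<Sum>s\<in>S. (\<Prod>i<Suc n. \<pi> ((z(n := s)) i)) * G (z(n := s)))"
    by (simp add: lessThan_Suc sum_PiE_insert)
  also have "\<dots> = (\<Sum>z\<in>{..<n} \<rightarrow>\<^sub>E S. \<Sum>s\<in>S. \<pi> s * ((\<Prod>i<n. \<pi> (z i)) * G z))"
  proof (intro sum.cong refl)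
    fix z s
    have "(\<Prod>i<n. \<pi> ((z(n := s)) i)) = (\<Prod>i<n. \<pi> (z i))" by (intro prod.cong) auto
    moreover have "G (z(n := s)) = G z" using step.hyps(1) by (intro G) auto
    ultimately show "(\<Prod>i<Suc n. \<pi> ((z(n := s)) i)) * G (z(n := s)) = \<pi> s * ((\<Prod>i<n. \<pi> (z i)) * G z)"
      by simp
  qed
  also have "\<dots> = (\<Sum>z\<in>{..<n} \<rightarrow>\<^sub>E S. (\<Prod>i<n. \<pi> (z i)) * G z)"
    by (simp add: sum_distrib_right[symmetric] one)
  finally show ?case using step.IH by simp
qed

lemma joint_law_edge_cylinder_restrict:
  fixes \<mu> :: "nat \<Rightarrow> nat \<Rightarrow> 'a::euclidean_space measure"
  assumes P: "np_wrgmm_param Q \<pi> \<mu>" and J: "J \<subseteq> edges m" and "m \<le> n"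
    and Y: "\<And>e. e \<in> J \<Longrightarrow> Y e \<in> sets borel"
  shows "joint_law Q \<pi> \<mu> n (edge_cylinder n J Y) =
    (\<Sum>z\<in>{..<m} \<rightarrow>\<^sub>E {1..Q}. (\<Prod>i<m. \<pi> (z i)) *
        (\<Prod>e\<in>J. measure (\<mu> (z (fst e)) (z (snd e))) (Y e)))"
proof -
  have "J \<subseteq> edges n" using J edges_mono[OF \<open>m \<le> n\<close>] by blast
  then have "joint_law Q \<pi> \<mu> n (edge_cylinder n J Y) =
      (\<Sum>z\<in>{..<n} \<rightarrow>\<^sub>E {1..Q}. (\<Prod>i<n. \<pi> (z i)) *
        (\<Prod>e\<in>J. measure (\<mu> (z (fst e)) (z (snd e))) (Y e)))"
    by (rule joint_law_edge_cylinder[OF P _ Y])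
  also have "\<dots> = (\<Sum>z\<in>{..<m} \<rightarrow>\<^sub>E {1..Q}. (\<Prod>i<m. \<pi> (z i)) *
        (\<Prod>e\<in>J. measure (\<mu> (z (fst e)) (z (snd e))) (Y e)))"
  proof (rule sum_unused_latent[OF _ \<open>m \<le> n\<close>])
    show "(\<Sum>s\<in>{1..Q}. \<pi> s) = 1" using P by (simp add: np_wrgmm_param_def)
    fix z z' :: "nat \<Rightarrow> nat" assume "\<And>i. i < m \<Longrightarrow> z i = z' i"
    then show "(\<Prod>e\<in>J. measure (\<mu> (z (fst e)) (z (snd e))) (Y e)) =
        (\<Prod>e\<in>J. measure (\<mu> (z' (fst e)) (z' (snd e))) (Y e))"
      using J by (intro prod.cong) (auto simp: edges_def)
  qed
  finally show ?thesis .
qed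

lemma sum_PiE_four:
  "(\<Sum>z\<in>{..<4::nat} \<rightarrow>\<^sub>E S. F z) =
     (\<Sum>a\<in>S. \<Sum>b\<in>S. \<Sum>c\<in>S. \<Sum>d\<in>S. F ((\<lambda>_. undefined)(0 := a, 1 := b, 2 := c, 3 := d)))"
proof -
  have four: "{..<4::nat} = insert 3 (insert 2 (insert 1 (insert 0 {})))" by auto
  have "(\<Sum>z\<in>{..<4::nat} \<rightarrow>\<^sub>E S. F z) =
      (\<Sum>z\<in>{} \<rightarrow>\<^sub>E S. \<Sum>a\<in>S. \<Sum>b\<in>S. \<Sum>c\<in>S. \<Sum>d\<in>S. F (z(0 := a, 1 := b, 2 := c, 3 := d)))"
    unfolding four by (simp add: sum_PiE_insert)
  then show ?thesis by (simp add: fun_upd_def)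
qed

lemma star_cylinder_law:
  fixes \<mu> :: "nat \<Rightarrow> nat \<Rightarrow> 'a::euclidean_space measure"
  assumes P: "np_wrgmm_param Q \<pi> \<mu>" and "4 \<le> n"
    and ABC: "A \<in> sets borel" "B \<in> sets borel" "C \<in> sets borel"
  shows "joint_law Q \<pi> \<mu> n (edge_cylinder n {(0, 1), (0, 2), (0, 3)}
           (\<lambda>e. if e = (0, 1) then A else if e = (0, 2) then B else C)) =
    (\<Sum>q\<in>{1..Q}. \<pi> q * group_marginal Q \<pi> \<mu> q A * group_marginal Q \<pi> \<mu> q B *
       group_marginal Q \<pi> \<mu> q C)"
proof -
  have "joint_law Q \<pi> \<mu> n (edge_cylinder n {(0, 1), (0, 2), (0, 3)}
           (\<lambda>e. if e = (0, 1) then A else if e = (0, 2) then B else C)) =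
      (\<Sum>z\<in>{..<4::nat} \<rightarrow>\<^sub>E {1..Q}. (\<Prod>i<4. \<pi> (z i)) *
        (\<Prod>e\<in>{(0, 1), (0, 2), (0, 3)}. measure (\<mu> (z (fst e)) (z (snd e)))
          (if e = (0, 1) then A else if e = (0, 2) then B else C)))"
    by (rule joint_law_edge_cylinder_restrict[OF P _ \<open>4 \<le> n\<close>]) (use ABC in \<open>auto simp: edges_def\<close>)
  also have "\<dots> = (\<Sum>a\<in>{1..Q}. \<Sum>b\<in>{1..Q}. \<Sum>c\<in>{1..Q}. \<Sum>d\<in>{1..Q}. \<pi> a * \<pi> b * \<pi> c * \<pi> d *
        (measure (\<mu> a b) A * measure (\<mu> a c) B * measure (\<mu> a d) C))"
    unfolding sum_PiE_four by (simp add: lessThan_nat_numeral mult_ac)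
  also have "\<dots> = (\<Sum>q\<in>{1..Q}. \<pi> q * group_marginal Q \<pi> \<mu> q A * group_marginal Q \<pi> \<mu> q B *
       group_marginal Q \<pi> \<mu> q C)"
    by (simp add: group_marginal_def sum_distrib_left sum_distrib_right mult_ac)
  finally show ?thesis .
qed

lemma path_cylinder_law:
  fixes \<mu> :: "nat \<Rightarrow> nat \<Rightarrow> 'a::euclidean_space measure"
  assumes P: "np_wrgmm_param Q \<pi> \<mu>" and "4 \<le> n"
    and ABC: "A \<in> sets borel" "B \<in> sets borel" "C \<in> sets borel"
  shows "joint_law Q \<pi> \<mu> n (edge_cylinder n {(0, 1), (0, 2), (1, 3)}
           (\<lambda>e. if e = (0, 1) then A else if e = (0, 2) then B else C)) =
    (\<Sum>q\<in>{1..Q}. \<Sum>l\<in>{1..Q}. (\<pi> q * \<pi> l * measure (\<mu> q l) A) *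
       group_marginal Q \<pi> \<mu> q B * group_marginal Q \<pi> \<mu> l C)"
proof -
  have "joint_law Q \<pi> \<mu> n (edge_cylinder n {(0, 1), (0, 2), (1, 3)}
           (\<lambda>e. if e = (0, 1) then A else if e = (0, 2) then B else C)) =
      (\<Sum>z\<in>{..<4::nat} \<rightarrow>\<^sub>E {1..Q}. (\<Prod>i<4. \<pi> (z i)) *
        (\<Prod>e\<in>{(0, 1), (0, 2), (1, 3)}. measure (\<mu> (z (fst e)) (z (snd e)))
          (if e = (0, 1) then A else if e = (0, 2) then B else C)))"
    by (rule joint_law_edge_cylinder_restrict[OF P _ \<open>4 \<le> n\<close>]) (use ABC in \<open>auto simp: edges_def\<close>)
  also have "\<dots> = (\<Sum>a\<in>{1..Q}. \<Sum>b\<in>{1..Q}. \<Sum>c\<in>{1..Q}. \<Sum>d\<in>{1..Q}. \<pi> a * \<pi> b * \<pi> c * \<pi> d *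
        (measure (\<mu> a b) A * measure (\<mu> a c) B * measure (\<mu> b d) C))"
    unfolding sum_PiE_four by (simp add: lessThan_nat_numeral mult_ac)
  also have "\<dots> = (\<Sum>q\<in>{1..Q}. \<Sum>l\<in>{1..Q}. (\<pi> q * \<pi> l * measure (\<mu> q l) A) *
       group_marginal Q \<pi> \<mu> q B * group_marginal Q \<pi> \<mu> l C)"
    by (simp add: group_marginal_def sum_distrib_left sum_distrib_right mult_ac)
  finally show ?thesis .
qed

subsection \<open>Recovering the edge laws\<close>

lemma double_sum_delta:
  fixes w :: "'i \<Rightarrow> 'i \<Rightarrow> real"
  assumes "finite S" "k \<in> S" "l \<in> S"
    and "\<And>a. a \<in> S \<Longrightarrow> d a = (if a = k then 1 else 0)"
    and "\<And>b. b \<in> S \<Longrightarrow> d' b = (if b = l then 1 else 0)"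
  shows "(\<Sum>a\<in>S. \<Sum>b\<in>S. w a b * d a * d' b) = w k l"
proof -
  have "(\<Sum>a\<in>S. \<Sum>b\<in>S. w a b * d a * d' b) =
      (\<Sum>a\<in>S. if a = k then (\<Sum>b\<in>S. if b = l then w a b else 0) else 0)"
    using assms(4,5) by (intro sum.cong refl) (auto intro!: sum.cong)
  then show ?thesis using assms(1-3) by simp
qed

lemma bilinear_coefficients_match:
  assumes S: "finite S" and g: "dual_family X S f g"
    and \<sigma>: "\<And>j. j \<in> S \<Longrightarrow> \<sigma> j \<in> S" "inj_on \<sigma> S"
    and h: "\<And>j A. j \<in> S \<Longrightarrow> A \<in> X \<Longrightarrow> h j A = f (\<sigma> j) A"
    and eq: "\<And>B C. B \<in> X \<Longrightarrow> C \<in> X \<Longrightarrow>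
      (\<Sum>a\<in>S. \<Sum>b\<in>S. W a b * f a B * f b C) = (\<Sum>a\<in>S. \<Sum>b\<in>S. W' a b * h a B * h b C)"
    and ql: "q \<in> S" "l \<in> S"
  shows "W' q l = W (\<sigma> q) (\<sigma> l)"
proof -
  let ?u = "g (\<sigma> q)" and ?v = "g (\<sigma> l)"
  have pts: "comb_points (g (\<sigma> k)) \<subseteq> X" if "k \<in> S" for k
    using g \<sigma>(1)[OF that] by (simp add: dual_family_def)
  have dual_h: "eval_comb (g (\<sigma> k)) (h a) = (if a = k then 1 else 0)" if "k \<in> S" "a \<in> S" for k a
  proof -
    have "eval_comb (g (\<sigma> k)) (h a) = eval_comb (g (\<sigma> k)) (f (\<sigma> a))"
      using h that by (intro eval_comb_cong[OF pts]) auto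
    also have "\<dots> = (if \<sigma> a = \<sigma> k then 1 else 0)"
      using g \<sigma>(1) that by (simp add: dual_family_def)
    finally show ?thesis using \<sigma>(2) that by (auto dest: inj_onD)
  qed
  have "W (\<sigma> q) (\<sigma> l) = (\<Sum>a\<in>S. \<Sum>b\<in>S. W a b * eval_comb ?u (f a) * eval_comb ?v (f b))"
    using g \<sigma>(1) ql by (intro double_sum_delta[symmetric] S) (auto simp: dual_family_def)
  also have "\<dots> = eval_comb ?u (\<lambda>B. eval_comb ?v (\<lambda>C. \<Sum>a\<in>S. \<Sum>b\<in>S. W a b * f a B * f b C))"
    by (simp add: eval_comb_linear mult_ac)
  also have "\<dots> = eval_comb ?u (\<lambda>B. eval_comb ?v (\<lambda>C. \<Sum>a\<in>S. \<Sum>b\<in>S. W' a b * h a B * h b C))"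
    by (intro eval_comb2_cong[OF pts[OF ql(1)] pts[OF ql(2)]] eq)
  also have "\<dots> = (\<Sum>a\<in>S. \<Sum>b\<in>S. W' a b * eval_comb ?u (h a) * eval_comb ?v (h b))"
    by (simp add: eval_comb_linear mult_ac)
  also have "\<dots> = W' q l"
    using dual_h ql by (intro double_sum_delta S) auto
  finally show ?thesis by simp
qed

lemma edge_laws_recovered:
  fixes \<mu> \<mu>' :: "nat \<Rightarrow> nat \<Rightarrow> 'a::euclidean_space measure"
  assumes P: "np_wrgmm_param Q \<pi> \<mu>" and P': "np_wrgmm_param Q \<pi>' \<mu>'"
    and indep: "lin_indep_on (sets borel) {1..Q} (group_marginal Q \<pi> \<mu>)"
    and \<sigma>: "\<And>j. j \<in> {1..Q} \<Longrightarrow> \<sigma> j \<in> {1..Q}" "inj_on \<sigma> {1..Q}"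
    and \<pi>_eq: "\<And>j. j \<in> {1..Q} \<Longrightarrow> \<pi>' j = \<pi> (\<sigma> j)"
    and marginal_eq: "\<And>j A. j \<in> {1..Q} \<Longrightarrow> A \<in> sets borel \<Longrightarrow>
      group_marginal Q \<pi>' \<mu>' j A = group_marginal Q \<pi> \<mu> (\<sigma> j) A"
    and path: "\<And>A B C. A \<in> sets borel \<Longrightarrow> B \<in> sets borel \<Longrightarrow> C \<in> sets borel \<Longrightarrow>
      (\<Sum>q\<in>{1..Q}. \<Sum>l\<in>{1..Q}. (\<pi> q * \<pi> l * measure (\<mu> q l) A) *
         group_marginal Q \<pi> \<mu> q B * group_marginal Q \<pi> \<mu> l C) =
      (\<Sum>q\<in>{1..Q}. \<Sum>l\<in>{1..Q}. (\<pi>' q * \<pi>' l * measure (\<mu>' q l) A) *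
         group_marginal Q \<pi>' \<mu>' q B * group_marginal Q \<pi>' \<mu>' l C)"
    and ql: "q \<in> {1..Q}" "l \<in> {1..Q}"
  shows "\<mu>' q l = \<mu> (\<sigma> q) (\<sigma> l)"
proof (rule np_edge_law_eqI)
  show "np_edge_law (\<mu>' q l)" using P' ql by (rule np_wrgmm_param_edge_law)
  show "np_edge_law (\<mu> (\<sigma> q) (\<sigma> l))" using P \<sigma>(1) ql by (intro np_wrgmm_param_edge_law) auto
  obtain g where g: "dual_family (sets borel) {1..Q} (group_marginal Q \<pi> \<mu>) g"
    using dual_family_exists[OF _ indep] by auto
  fix A :: "'a set" assume A: "A \<in> sets borel"
  have "(\<lambda>a b. \<pi>' a * \<pi>' b * measure (\<mu>' a b) A) q l =
      (\<lambda>a b. \<pi> a * \<pi> b * measure (\<mu> a b) A) (\<sigma> q) (\<sigma> l)"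
  proof (rule bilinear_coefficients_match[OF _ g \<sigma> marginal_eq _ ql])
    fix B C :: "'a set" assume "B \<in> sets borel" "C \<in> sets borel"
    then show "(\<Sum>a\<in>{1..Q}. \<Sum>b\<in>{1..Q}. (\<lambda>a b. \<pi> a * \<pi> b * measure (\<mu> a b) A) a b *
        group_marginal Q \<pi> \<mu> a B * group_marginal Q \<pi> \<mu> b C) =
      (\<Sum>a\<in>{1..Q}. \<Sum>b\<in>{1..Q}. (\<lambda>a b. \<pi>' a * \<pi>' b * measure (\<mu>' a b) A) a b *
        group_marginal Q \<pi>' \<mu>' a B * group_marginal Q \<pi>' \<mu>' b C)"
      using path[OF A] by simp
  qed simp
  moreover have "\<pi> (\<sigma> q) > 0" "\<pi> (\<sigma> l) > 0"
    using P \<sigma>(1) ql by (auto simp: np_wrgmm_param_def)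
  ultimately show "measure (\<mu>' q l) A = measure (\<mu> (\<sigma> q) (\<sigma> l)) A"
    using \<pi>_eq ql by simp
qed

subsection \<open>Identifiability from the law of \<open>K_9\<close>\<close>

lemma three_edge_moments_eq:
  fixes \<mu> \<mu>' :: "nat \<Rightarrow> nat \<Rightarrow> 'a::euclidean_space measure"
  assumes P: "np_wrgmm_param Q \<pi> \<mu>" and P': "np_wrgmm_param Q \<pi>' \<mu>'" and "4 \<le> n"
    and eq: "\<forall>A\<in>sets (PiM (edges n) (\<lambda>_. (borel :: 'a measure))).
           joint_law Q \<pi> \<mu> n A = joint_law Q \<pi>' \<mu>' n A"
    and ABC: "A \<in> sets borel" "B \<in> sets borel" "C \<in> sets borel"
  shows "(\<Sum>q\<in>{1..Q}. \<pi> q * group_marginal Q \<pi> \<mu> q A * group_marginal Q \<pi> \<mu> q B *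
           group_marginal Q \<pi> \<mu> q C) =
         (\<Sum>q\<in>{1..Q}. \<pi>' q * group_marginal Q \<pi>' \<mu>' q A * group_marginal Q \<pi>' \<mu>' q B *
           group_marginal Q \<pi>' \<mu>' q C)" (is ?star)
    and "(\<Sum>q\<in>{1..Q}. \<Sum>l\<in>{1..Q}. (\<pi> q * \<pi> l * measure (\<mu> q l) A) *
           group_marginal Q \<pi> \<mu> q B * group_marginal Q \<pi> \<mu> l C) =
         (\<Sum>q\<in>{1..Q}. \<Sum>l\<in>{1..Q}. (\<pi>' q * \<pi>' l * measure (\<mu>' q l) A) *
           group_marginal Q \<pi>' \<mu>' q B * group_marginal Q \<pi>' \<mu>' l C)" (is ?path)
proof -
  let ?Y = "\<lambda>e. if e = (0, 1) then A else if e = (0, 2) then B else C"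
  have cylinders_eq: "joint_law Q \<pi> \<mu> n (edge_cylinder n J ?Y) = joint_law Q \<pi>' \<mu>' n (edge_cylinder n J ?Y)"
    if "J \<subseteq> edges n" for J
    using eq edge_cylinder_measurable[OF that, of ?Y] ABC by auto
  have star: "joint_law Q \<pi> \<mu> n (edge_cylinder n {(0, 1), (0, 2), (0, 3)} ?Y) =
      joint_law Q \<pi>' \<mu>' n (edge_cylinder n {(0, 1), (0, 2), (0, 3)} ?Y)"
    and path: "joint_law Q \<pi> \<mu> n (edge_cylinder n {(0, 1), (0, 2), (1, 3)} ?Y) =
      joint_law Q \<pi>' \<mu>' n (edge_cylinder n {(0, 1), (0, 2), (1, 3)} ?Y)"
    by (rule cylinders_eq; use \<open>4 \<le> n\<close> in \<open>auto simp: edges_def\<close>)+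
  show ?star
    using star unfolding star_cylinder_law[OF P \<open>4 \<le> n\<close> ABC] star_cylinder_law[OF P' \<open>4 \<le> n\<close> ABC] .
  show ?path
    using path unfolding path_cylinder_law[OF P \<open>4 \<le> n\<close> ABC] path_cylinder_law[OF P' \<open>4 \<le> n\<close> ABC] .
qed

lemma inj_endo_extends_to_permutation:
  assumes "finite S" "\<And>x. x \<in> S \<Longrightarrow> \<sigma> x \<in> S" "inj_on \<sigma> S"
  shows "\<exists>\<tau>. \<tau> permutes S \<and> (\<forall>x\<in>S. \<tau> x = \<sigma> x)"
proof -
  define \<tau> where "\<tau> x = (if x \<in> S then \<sigma> x else x)" for x
  have "\<sigma> ` S = S" using assms by (intro endo_inj_surj) auto
  then have "bij_betw \<sigma> S S" using assms(3) by (simp add: bij_betw_def)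
  then have "bij_betw \<tau> S S" by (rule bij_betw_cong[THEN iffD1, rotated]) (simp add: \<tau>_def)
  then have "\<tau> permutes S" by (rule bij_imp_permutes) (simp add: \<tau>_def)
  then show ?thesis by (auto simp: \<tau>_def)
qed

theorem theorem8:
  fixes Q :: nat and \<pi> \<pi>' :: "nat \<Rightarrow> real"
    and \<mu> \<mu>' :: "nat \<Rightarrow> nat \<Rightarrow> 'a::euclidean_space measure"
  assumes "Q \<ge> 2"
    and "np_wrgmm_param Q \<pi> \<mu>" and "measures_lin_indep Q \<mu>"
    and "np_wrgmm_param Q \<pi>' \<mu>'" and "measures_lin_indep Q \<mu>'"
    and "\<forall>A\<in>sets (PiM (edges 9) (\<lambda>_. (borel :: 'a measure))).
           joint_law Q \<pi> \<mu> 9 A = joint_law Q \<pi>' \<mu>' 9 A"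
  shows "\<exists>\<sigma>. \<sigma> permutes {1..Q} \<and> (\<forall>q\<in>{1..Q}. \<pi>' q = \<pi> (\<sigma> q)) \<and>
           (\<forall>q\<in>{1..Q}. \<forall>l\<in>{1..Q}. \<mu>' q l = \<mu> (\<sigma> q) (\<sigma> l))"
proof -
  note P = assms(2) and P' = assms(4)
  have "4 \<le> (9::nat)" by simp
  note moments = three_edge_moments_eq[OF P P' this assms(6)]
  have indep: "lin_indep_on (sets borel) {1..Q} (group_marginal Q \<pi> \<mu>)"
    and indep': "lin_indep_on (sets borel) {1..Q} (group_marginal Q \<pi>' \<mu>')"
    using group_marginals_lin_indep assms(2-5) by blast+
  have nz: "\<pi>' j \<noteq> 0" if "j \<in> {1..Q}" for j
    using P' that by (force simp: np_wrgmm_param_def)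
  have "\<exists>\<sigma>. (\<forall>j\<in>{1..Q}. \<sigma> j \<in> {1..Q}) \<and> inj_on \<sigma> {1..Q} \<and> (\<forall>j\<in>{1..Q}. \<pi>' j = \<pi> (\<sigma> j) \<and>
      (\<forall>A\<in>sets borel. group_marginal Q \<pi>' \<mu>' j A = group_marginal Q \<pi> \<mu> (\<sigma> j) A))"
    by (rule third_moment_decomposition_unique[where f="group_marginal Q \<pi> \<mu>"
          and h="group_marginal Q \<pi>' \<mu>'" and U=UNIV, OF _ moments(1) indep indep' nz _
          group_marginal_UNIV[OF P] group_marginal_UNIV[OF P']]) simp_all
  then obtain \<sigma> where \<sigma>: "\<And>j. j \<in> {1..Q} \<Longrightarrow> \<sigma> j \<in> {1..Q}" "inj_on \<sigma> {1..Q}"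
    and \<pi>_eq: "\<And>j. j \<in> {1..Q} \<Longrightarrow> \<pi>' j = \<pi> (\<sigma> j)"
    and marginal_eq: "\<And>j A. j \<in> {1..Q} \<Longrightarrow> A \<in> sets borel \<Longrightarrow>
      group_marginal Q \<pi>' \<mu>' j A = group_marginal Q \<pi> \<mu> (\<sigma> j) A"
    by blast
  have "\<mu>' q l = \<mu> (\<sigma> q) (\<sigma> l)" if "q \<in> {1..Q}" "l \<in> {1..Q}" for q l
    by (rule edge_laws_recovered[OF P P' indep \<sigma> \<pi>_eq marginal_eq moments(2) that])
  moreover obtain \<tau> where "\<tau> permutes {1..Q}" "\<forall>x\<in>{1..Q}. \<tau> x = \<sigma> x"
    using inj_endo_extends_to_permutation[OF _ \<sigma>] by auto
  ultimately show ?thesis using \<pi>_eq by auto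
qed

end
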